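(* For every real $x$ with $0<|x|<\frac{\pi}{2}$, $$4+\frac{1}{10}x^3\sin x<3\,\frac{x}{\sin x}+\cos x<4+\frac{12\pi-32}{\pi^3}x^3\sin x.$$ Moreover, the constants $\frac{1}{10}$ and $\frac{12\pi-32}{\pi^3}$ are the best possible.
   Context: "Best possible" means that the constant in the lower bound cannot be replaced by any larger real constant, and the constant in the upper bound cannot be replaced by any smaller real constant, with the corresponding inequality still holding for all $x$ in the stated range. *)

theory Defs
  imports Complex_Main
begin

end

theory Submission
  imports Defs "HOL-Analysis.Complex_Transcendental" "HOL-Real_Asymp.Real_Asymp"
begin

text \<open>
  Write \<open>f x = (3 x / sin x + cos x - 4) / (x^3 sin x)\<close>, an even function. It tends to \<open>1/10\<close> at \<open>0\<close> and
  equals \<open>(12 \<pi> - 32) / \<pi>^3\<close> at \<open>\<pi>/2\<close>, so neither constant can be improved. After multiplication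
  by \<open>sin x\<close>, the two bounds compare \<open>3 x + sin x cos x - 4 sin x\<close> with \<open>c x^3 sin\<^sup>2 x\<close>. In terms of
  the double angle, the lower bound follows from Taylor polynomials on the whole interval. So
  does the upper bound on \<open>(0, 1.46]\<close>, where it holds even with \<open>c = 0.18\<close>; on \<open>[1.46, \<pi>/2]\<close> the
  difference of the two sides is strictly increasing and vanishes at \<open>\<pi>/2\<close>.
\<close>

section \<open>Taylor bounds for sine and cosine\<close>

text \<open>The Maclaurin error after the terms of degree below \<open>n\<close> is at most
  \<open>x^n / n!\<close>. For odd \<open>n\<close> this is the size of the next Taylor term, so one
  side of the estimate is the next partial sum.\<close>

lemma sin_Taylor_bounds:
  fixes x :: real
  assumes "0 \<le> x"
  shows "sin x \<le> x - x^3 / 6 + x^5 / 120"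
    and "x - x^3 / 6 + x^5 / 120 - x^7 / 5040 \<le> sin x"
    and "sin x \<le> x - x^3 / 6 + x^5 / 120 - x^7 / 5040 + x^9 / 362880"
proof -
  note b = Maclaurin_sin_bound[of x]
  show "sin x \<le> x - x^3 / 6 + x^5 / 120"
    using b[of 5] assms by (simp add: sin_coeff_def lessThan_nat_numeral fact_numeral abs_if split: if_splits)
  show "x - x^3 / 6 + x^5 / 120 - x^7 / 5040 \<le> sin x"
    using b[of 7] assms by (simp add: sin_coeff_def lessThan_nat_numeral fact_numeral abs_if split: if_splits)
  show "sin x \<le> x - x^3 / 6 + x^5 / 120 - x^7 / 5040 + x^9 / 362880"
    using b[of 9] assms by (simp add: sin_coeff_def lessThan_nat_numeral fact_numeral abs_if split: if_splits)
qed

lemma cos_Taylor_bounds: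
  fixes x :: real
  shows "1 - x^2 / 2 + x^4 / 24 - x^6 / 720 \<le> cos x"
    and "cos x \<le> 1 - x^2 / 2 + x^4 / 24 - x^6 / 720 + x^8 / 40320"
proof -
  \<comment> \<open>For even \<open>n\<close> the power \<open>x^n\<close> is nonnegative, so the
    error bound needs no sign condition on \<open>x\<close>.\<close>
  have *: "\<bar>cos x - (\<Sum>m<n. cos_coeff m * x ^ m)\<bar> \<le> x ^ n / fact n" if "even n" for n
  proof -
    obtain t where t: "cos x = (\<Sum>m<n. cos_coeff m * x ^ m) + cos (t + 1/2 * real n * pi) / fact n * x ^ n"
      using Maclaurin_cos_expansion[of x n] by blast
    have "\<bar>cos (t + 1/2 * real n * pi)\<bar> * (x ^ n / fact n) \<le> 1 * (x ^ n / fact n)"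
      using that by (intro mult_right_mono) auto
    then show ?thesis
      using t that by (simp add: abs_mult zero_le_even_power)
  qed
  show "1 - x^2 / 2 + x^4 / 24 - x^6 / 720 \<le> cos x"
    using *[of 6] by (simp add: cos_coeff_def lessThan_nat_numeral fact_numeral abs_if split: if_splits)
  show "cos x \<le> 1 - x^2 / 2 + x^4 / 24 - x^6 / 720 + x^8 / 40320"
    using *[of 8] by (simp add: cos_coeff_def lessThan_nat_numeral fact_numeral abs_if split: if_splits)
qed

lemma sin_cos_double: "sin x * cos x = sin (2 * x) / 2" for x :: real
  by (simp add: sin_double)

lemma sin_sq_double: "(sin x)\<^sup>2 = (1 - cos (2 * x)) / 2" for x :: real
  by (simp add: cos_double_sin)

section \<open>The inequalities multiplied by the sine\<close>

text \<open>After Taylor expansion both sides begin with \<open>x^5 / 10\<close>. These terms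
  cancel, and the rest is \<open>x^7\<close> times a factor that stays positive since
  \<open>x < 1.6\<close>.\<close>

lemma lower_polynomial_form:
  fixes x :: real
  assumes "0 < x" "x < pi / 2"
  shows "x^3 * (sin x)\<^sup>2 / 10 < 3 * x + sin x * cos x - 4 * sin x"
proof -
  have s2: "2*x - (2*x)^3 / 6 + (2*x)^5 / 120 - (2*x)^7 / 5040 \<le> sin (2 * x)"
    using assms by (intro sin_Taylor_bounds) simp
  have s1: "sin x \<le> x - x^3 / 6 + x^5 / 120"
    using assms by (intro sin_Taylor_bounds) simp
  have "x^3 * (sin x)\<^sup>2 \<le> x^3 * ((2*x)^2 / 2 - (2*x)^4 / 24 + (2*x)^6 / 720) / 2"
    unfolding sin_sq_double using assms cos_Taylor_bounds(1)[of "2 * x"]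
    by (simp add: mult_left_mono del: power_mult_distrib)
  also have "\<dots> = x^5 - x^7 / 3 + 2 * x^9 / 45"
    by (simp add: field_simps eval_nat_numeral)
  finally have q: "x^3 * (sin x)\<^sup>2 \<le> x^5 - x^7 / 3 + 2 * x^9 / 45" .
  have "x < 16 / 10"
    using assms pi_approx by simp
  then have "x\<^sup>2 < (16/10)\<^sup>2"
    using assms by (intro power_strict_mono) auto
  then have "0 < x^7 * (1/30 - 4/315 - x\<^sup>2 / 225)"
    using assms by (intro mult_pos_pos) (auto simp: power2_eq_square)
  also have "\<dots> = x^7 / 30 - 4 * x^7 / 315 - x^9 / 225"
    by (simp add: algebra_simps eval_nat_numeral)
  finally have pos: "0 < x^7 / 30 - 4 * x^7 / 315 - x^9 / 225" .
  show ?thesis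
    using s2 s1 q pos unfolding sin_cos_double by (simp add: power_mult_distrib)
qed

lemma upper_polynomial_form_left:
  fixes x :: real
  assumes "0 < x" "x \<le> 146 / 100"
  shows "3 * x + sin x * cos x - 4 * sin x < 18 / 100 * (x^3 * (sin x)\<^sup>2)"
proof -
  have s2: "sin (2 * x) \<le> 2*x - (2*x)^3 / 6 + (2*x)^5 / 120 - (2*x)^7 / 5040 + (2*x)^9 / 362880"
    using assms by (intro sin_Taylor_bounds) simp
  have s1: "x - x^3 / 6 + x^5 / 120 - x^7 / 5040 \<le> sin x"
    using assms by (intro sin_Taylor_bounds) simp
  have "x^5 - x^7 / 3 + 2 * x^9 / 45 - x^11 / 315 =
      x^3 * ((2*x)^2 / 2 - (2*x)^4 / 24 + (2*x)^6 / 720 - (2*x)^8 / 40320) / 2"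
    by (simp add: field_simps eval_nat_numeral)
  also have "\<dots> \<le> x^3 * (sin x)\<^sup>2"
    unfolding sin_sq_double using assms cos_Taylor_bounds(2)[of "2 * x"]
    by (simp add: mult_left_mono del: power_mult_distrib)
  finally have q: "x^5 - x^7 / 3 + 2 * x^9 / 45 - x^11 / 315 \<le> x^3 * (sin x)\<^sup>2" .
  define t where "t = x\<^sup>2"
  have "t \<le> (146/100)\<^sup>2" "0 \<le> t"
    unfolding t_def using assms by (auto intro: power_mono)
  then have t: "0 \<le> t" "t \<le> 2132 / 1000"
    by (auto simp: power2_eq_square)
  \<comment> \<open>Up to the factor \<open>x^5\<close>, the Taylor bounds leave a cubic in
    \<open>t\<close>. This estimate lowers it to a quadratic with negative leading coefficient,
    which a lower bound on \<open>t\<^sup>2\<close> then makes linear. The number 2.132 is 1.46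
    squared, rounded up.\<close>
  have t3: "t^3 \<le> 2132 / 1000 * t\<^sup>2"
    using mult_right_mono[OF t(2), of "t\<^sup>2"] by (simp add: power3_eq_cube power2_eq_square)
  \<comment> \<open>The tangent of \<open>t\<^sup>2\<close> at the right end point, where the cubic below is nearly zero.\<close>
  have "0 \<le> (t - 2132/1000)\<^sup>2"
    by simp
  then have t2: "2 * (2132/1000) * t - (2132/1000)\<^sup>2 \<le> t\<^sup>2"
    by (simp add: power2_diff algebra_simps)
  have "- (8/100) + (6/100 - 15/1260) * t - (8/1000 - 2/2835) * t\<^sup>2 + 18/31500 * t^3 < 0"
    using t t2 t3 by (simp add: power2_eq_square[of "_ / _"])
  then have "x^5 * (- (8/100) + (6/100 - 15/1260) * t - (8/1000 - 2/2835) * t\<^sup>2 + 18/31500 * t^3) < 0"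
    using assms by (intro mult_pos_neg) auto
  also have "x^5 * (- (8/100) + (6/100 - 15/1260) * t - (8/1000 - 2/2835) * t\<^sup>2 + 18/31500 * t^3) =
      - (8/100) * x^5 + (6/100 - 15/1260) * x^7 - (8/1000 - 2/2835) * x^9 + 18/31500 * x^11"
    by (simp add: t_def algebra_simps eval_nat_numeral)
  finally show ?thesis
    using s2 s1 q unfolding sin_cos_double by (simp add: power_mult_distrib)
qed

text \<open>The constant is about 0.1838. The lower estimate lets 0.18 stand in for it away from
  \<open>pi / 2\<close>; the upper one controls a derivative near \<open>pi / 2\<close>.\<close>

lemma upper_constant_bounds:
  defines "c \<equiv> (12 * pi - 32) / pi ^ 3"
  shows "18 / 100 \<le> c" "c \<le> 1845 / 10000"
proof -
  have pi: "3141 / 1000 \<le> pi" "pi \<le> 31416 / 10000"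
    using pi_approx by simp_all
  have "pi ^ 3 \<le> (31416 / 10000) ^ 3" "(3141 / 1000) ^ 3 \<le> pi ^ 3"
    using pi by (auto intro!: power_mono)
  then show "18 / 100 \<le> c" "c \<le> 1845 / 10000"
    using pi by (simp_all add: c_def field_simps)
qed

lemma upper_polynomial_form_right:
  fixes x :: real
  defines "c \<equiv> (12 * pi - 32) / pi ^ 3"
  assumes "146 / 100 \<le> x" "x < pi / 2"
  shows "3 * x + sin x * cos x - 4 * sin x < c * (x^3 * (sin x)\<^sup>2)"
proof -
  define g where "g y = 3 * y + sin y * cos y - 4 * sin y - c * (y^3 * (sin y)\<^sup>2)" for y
  define g' where "g' y = 3 + ((cos y)\<^sup>2 - (sin y)\<^sup>2) - 4 * cos y
      - c * (3 * y\<^sup>2 * (sin y)\<^sup>2 + 2 * y^3 * (sin y * cos y))" for y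
  have c: "0 \<le> c" "c \<le> 1845 / 10000"
    using upper_constant_bounds unfolding c_def by linarith+
  have deriv: "(g has_real_derivative g' y) (at y)" for y
    unfolding g_def g'_def
    by (rule derivative_eq_intros refl | simp add: algebra_simps power2_eq_square)+
  have pos: "g' y > 0" if y: "x \<le> y" "y \<le> pi / 2" for y
  proof -
    have yb: "146 / 100 \<le> y" "y \<le> 1571 / 1000"
      using y assms pi_approx by auto
    have k0: "0 \<le> cos y" and s0: "0 \<le> sin y"
      using y yb by (auto intro!: cos_ge_zero sin_ge_zero)
    \<comment> \<open>Near \<open>pi / 2\<close> the cosine is small: it is the sine of the
      complementary angle, hence at most that angle.\<close>
    have "cos y \<le> pi / 2 - y"
      using sin_x_le_x[of "pi / 2 - y"] y by (simp add: sin_diff)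
    then have k: "cos y \<le> 111 / 1000"
      using yb pi_approx by simp
    have "y\<^sup>2 \<le> (1571/1000)\<^sup>2" "y^3 \<le> (1571/1000)^3"
      using yb by (auto intro!: power_mono)
    then have "y\<^sup>2 \<le> 2469/1000" "y^3 \<le> 3878/1000"
      by (auto simp: power2_eq_square power3_eq_cube)
    moreover have "(sin y)\<^sup>2 \<le> 1" "sin y * cos y \<le> 111/1000"
      using mult_mono[of "sin y" 1 "cos y" "111/1000"] s0 k0 k by (auto simp: power_le_one)
    ultimately have "y\<^sup>2 * (sin y)\<^sup>2 \<le> 2469/1000 * 1" "y^3 * (sin y * cos y) \<le> 3878/1000 * (111/1000)"
      using s0 k0 by (intro mult_mono; simp)+
    then have "3 * y\<^sup>2 * (sin y)\<^sup>2 + 2 * y^3 * (sin y * cos y) \<le> 8269/1000"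
      by simp
    then have le: "c * (3 * y\<^sup>2 * (sin y)\<^sup>2 + 2 * y^3 * (sin y * cos y)) \<le> 1845/10000 * (8269/1000)"
      using c yb s0 k0 by (intro mult_mono) auto
    have "0 \<le> (cos y)\<^sup>2" "(sin y)\<^sup>2 = 1 - (cos y)\<^sup>2"
      by (simp_all add: sin_squared_eq)
    \<comment> \<open>The right side equals \<open>2 + 2 * (cos y)\<^sup>2 - 4 * cos y\<close>, at
      least 2 - 0.444 = 1.556, while the left side is below 1.526.\<close>
    then have "1845/10000 * (8269/1000) < 3 + ((cos y)\<^sup>2 - (sin y)\<^sup>2) - 4 * cos y"
      using k by linarith
    from le_less_trans[OF le this] show ?thesis
      unfolding g'_def by (simp only: diff_gt_0_iff_gt)
  qed
  have "g x < g (pi / 2)"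
    using deriv pos by (intro DERIV_pos_imp_increasing[OF \<open>x < pi / 2\<close>]) blast
  \<comment> \<open>This equation, \<open>3 * pi / 2 - 4 = c * pi^3 / 8\<close>, determines the
    value of \<open>c\<close>.\<close>
  also have "g (pi / 2) = 0"
    by (simp add: g_def c_def field_simps power3_eq_cube)
  finally show ?thesis
    by (simp add: g_def)
qed

lemma upper_polynomial_form:
  fixes x :: real
  assumes "0 < x" "x < pi / 2"
  shows "3 * x + sin x * cos x - 4 * sin x < (12 * pi - 32) / pi ^ 3 * (x^3 * (sin x)\<^sup>2)"
proof (cases "x \<le> 146 / 100")
  case True
  have "18 / 100 * (x^3 * (sin x)\<^sup>2) \<le> (12 * pi - 32) / pi ^ 3 * (x^3 * (sin x)\<^sup>2)"
    using upper_constant_bounds assms by (intro mult_right_mono) auto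
  then show ?thesis
    using upper_polynomial_form_left[OF assms(1) True] by linarith
next
  case False
  then show ?thesis
    using upper_polynomial_form_right assms by simp
qed

lemma bounds_pos:
  fixes x :: real
  assumes "0 < x" "x < pi / 2"
  shows "4 + 1 / 10 * x ^ 3 * sin x < 3 * (x / sin x) + cos x"
    and "3 * (x / sin x) + cos x < 4 + (12 * pi - 32) / pi ^ 3 * x ^ 3 * sin x"
proof -
  have s: "sin x > 0"
    using assms by (intro sin_gt_zero) auto
  have e: "(3 * (x / sin x) + cos x) * sin x = 3 * x + sin x * cos x"
    using s by (simp add: field_simps)
  have "(4 + 1 / 10 * x ^ 3 * sin x) * sin x < (3 * (x / sin x) + cos x) * sin x"
    unfolding e using lower_polynomial_form[OF assms] by (simp add: algebra_simps power2_eq_square)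
  then show "4 + 1 / 10 * x ^ 3 * sin x < 3 * (x / sin x) + cos x"
    using s by (simp only: mult_less_cancel_right_pos)
  define c where "c = (12 * pi - 32) / pi ^ 3"
  have "(3 * (x / sin x) + cos x) * sin x < (4 + c * x ^ 3 * sin x) * sin x"
    unfolding e using upper_polynomial_form[OF assms, folded c_def]
    by (simp add: algebra_simps power2_eq_square)
  then show "3 * (x / sin x) + cos x < 4 + (12 * pi - 32) / pi ^ 3 * x ^ 3 * sin x"
    unfolding c_def using s by (simp only: mult_less_cancel_right_pos)
qed

section \<open>Optimality of the constants\<close>

text \<open>The hypothesis puts \<open>c\<close> below the quotient on the whole interval, hence
  below its limit at 0.\<close>

lemma lower_constant_optimal:
  fixes c :: real
  assumes "\<And>x. 0 < x \<Longrightarrow> x < pi / 2 \<Longrightarrow> 4 + c * x ^ 3 * sin x < 3 * (x / sin x) + cos x"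
  shows "c \<le> 1 / 10"
proof (rule tendsto_lowerbound)
  show "((\<lambda>x::real. (3 * (x / sin x) + cos x - 4) / (x ^ 3 * sin x)) \<longlongrightarrow> 1 / 10) (at_right 0)"
    by real_asymp
  have "eventually (\<lambda>x::real. x \<in> {0<..<pi / 2}) (at_right 0)"
    by (intro eventually_at_right_real) simp
  then show "\<forall>\<^sub>F x in at_right 0. c \<le> (3 * (x / sin x) + cos x - 4) / (x ^ 3 * sin x)"
  proof eventually_elim
    case (elim x)
    then have "0 < x ^ 3 * sin x"
      by (intro mult_pos_pos sin_gt_zero) auto
    then show ?case
      using assms[of x] elim by (simp add: pos_le_divide_eq algebra_simps)
  qed
qed simp

text \<open>The quotient is continuous at \<open>pi / 2\<close>, which is outside the range of the
  hypothesis, so its value there is reached as a left limit.\<close>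

lemma upper_constant_optimal:
  fixes c :: real
  assumes "\<And>x. 0 < x \<Longrightarrow> x < pi / 2 \<Longrightarrow> 3 * (x / sin x) + cos x < 4 + c * x ^ 3 * sin x"
  shows "(12 * pi - 32) / pi ^ 3 \<le> c"
proof (rule tendsto_upperbound)
  have "((\<lambda>x::real. (3 * (x / sin x) + cos x - 4) / (x ^ 3 * sin x)) \<longlongrightarrow>
      (3 * (pi / 2 / sin (pi / 2)) + cos (pi / 2) - 4) / ((pi / 2) ^ 3 * sin (pi / 2))) (at_left (pi / 2))"
    by (intro tendsto_intros) auto
  also have "(3 * (pi / 2 / sin (pi / 2)) + cos (pi / 2) - 4) / ((pi / 2) ^ 3 * sin (pi / 2)) =
      (12 * pi - 32) / pi ^ 3"
    by (simp add: field_simps)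
  finally show "((\<lambda>x::real. (3 * (x / sin x) + cos x - 4) / (x ^ 3 * sin x)) \<longlongrightarrow>
      (12 * pi - 32) / pi ^ 3) (at_left (pi / 2))" .
  have "eventually (\<lambda>x::real. x \<in> {0<..<pi / 2}) (at_left (pi / 2))"
    by (intro eventually_at_left_real) simp
  then show "\<forall>\<^sub>F x in at_left (pi / 2). (3 * (x / sin x) + cos x - 4) / (x ^ 3 * sin x) \<le> c"
  proof eventually_elim
    case (elim x)
    then have "0 < x ^ 3 * sin x"
      by (intro mult_pos_pos sin_gt_zero) auto
    then show ?case
      using assms[of x] elim by (simp add: pos_divide_le_eq algebra_simps)
  qed
qed (simp add: trivial_limit_at_left_real)

theorem theorem3p5:
  shows "(\<forall>x::real. 0 < \<bar>x\<bar> \<and> \<bar>x\<bar> < pi / 2 \<longrightarrow>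
            4 + 1 / 10 * x ^ 3 * sin x < 3 * (x / sin x) + cos x \<and>
            3 * (x / sin x) + cos x < 4 + (12 * pi - 32) / pi ^ 3 * x ^ 3 * sin x)
       \<and> (\<forall>c::real. c > 1 / 10 \<longrightarrow>
            \<not> (\<forall>x::real. 0 < \<bar>x\<bar> \<and> \<bar>x\<bar> < pi / 2 \<longrightarrow>
                  4 + c * x ^ 3 * sin x < 3 * (x / sin x) + cos x))
       \<and> (\<forall>c::real. c < (12 * pi - 32) / pi ^ 3 \<longrightarrow>
            \<not> (\<forall>x::real. 0 < \<bar>x\<bar> \<and> \<bar>x\<bar> < pi / 2 \<longrightarrow>
                  3 * (x / sin x) + cos x < 4 + c * x ^ 3 * sin x))"
proof (intro conjI allI impI)
  fix x :: real
  assume x: "0 < \<bar>x\<bar> \<and> \<bar>x\<bar> < pi / 2"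
  show "4 + 1 / 10 * x ^ 3 * sin x < 3 * (x / sin x) + cos x"
    \<comment> \<open>Both sides are even in \<open>x\<close>, so the case of negative
      \<open>x\<close> is the bound at \<open>\<bar>x\<bar>\<close>.\<close>
    using bounds_pos(1)[of "\<bar>x\<bar>"] x by (cases "x \<ge> 0") auto
  show "3 * (x / sin x) + cos x < 4 + (12 * pi - 32) / pi ^ 3 * x ^ 3 * sin x"
    using bounds_pos(2)[of "\<bar>x\<bar>"] x by (cases "x \<ge> 0") auto
next
  fix c :: real
  assume "c > 1 / 10"
  \<comment> \<open>Restricting the supposed inequality to positive \<open>x\<close> already forces
    \<open>c \<le> 1 / 10\<close>.\<close>
  then show "\<not> (\<forall>x::real. 0 < \<bar>x\<bar> \<and> \<bar>x\<bar> < pi / 2 \<longrightarrow>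
      4 + c * x ^ 3 * sin x < 3 * (x / sin x) + cos x)"
    using lower_constant_optimal[of c] by fastforce
next
  fix c :: real
  assume "c < (12 * pi - 32) / pi ^ 3"
  then show "\<not> (\<forall>x::real. 0 < \<bar>x\<bar> \<and> \<bar>x\<bar> < pi / 2 \<longrightarrow>
      3 * (x / sin x) + cos x < 4 + c * x ^ 3 * sin x)"
    using upper_constant_optimal[of c] by fastforce
qed

end
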